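(* For any finite, simple, connected, undirected graphs $G$ and $H$: if $\gamma(G)$ is odd, then $$\gamma(G\,\square\, H)\geq \frac{\left\lceil \frac{\gamma (G)}{2}\right\rceil}{2\left\lceil \frac{\gamma (G)}{2}\right\rceil-1}\,\gamma(G)\,\gamma(H),$$ and if $\gamma(G)$ is even, then $$\gamma(G\,\square\, H)\geq \frac{\gamma (G)}{2\gamma (G)-2}\,\gamma(G)\,\gamma(H).$$
   Context: All graphs are finite, simple, connected and undirected (with nonempty vertex set). For a graph $G$ and $v\in V(G)$, $N[v]$ denotes the closed neighborhood of $v$ (that is, $v$ together with all its neighbors), and $N[S]=\bigcup_{v\in S}N[v]$ for $S\subseteq V(G)$. A set $S\subseteq V(G)$ dominates $G$ if $N[S]=V(G)$. The domination number $\gamma(G)$ is the minimum cardinality of a set that dominates $G$. The Cartesian product $G\,\square\,H$ is the graph with vertex set $V(G)\times V(H)$ in which $(u_1,v_1)$ and $(u_2,v_2)$ are adjacent if and only if either $v_1=v_2$ and $u_1u_2\in E(G)$, or $u_1=u_2$ and $v_1v_2\in E(H)$. *)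

theory Defs
  imports Complex_Main "Graph_Theory.Graph_Theory"
begin

text \<open>
  A finite simple undirected graph is a \<open>pair_graph\<close>: a finite, loop-free, symmetric digraph whose
  arcs are ordered pairs of vertices, so an edge \<open>uv\<close> is the pair of arcs \<open>(u, v)\<close>, \<open>(v, u)\<close>.
  Note that \<open>Digraph_Component.connected\<close> includes nonemptiness of the vertex set; it is written
  qualified to keep it apart from topological connectedness.
\<close>

definition closed_nbhd :: "'a pair_pre_digraph \<Rightarrow> 'a \<Rightarrow> 'a set" where
  "closed_nbhd G v = insert v {u. v \<rightarrow>\<^bsub>with_proj G\<^esub> u}"

definition closed_nbhd_set :: "'a pair_pre_digraph \<Rightarrow> 'a set \<Rightarrow> 'a set" where
  "closed_nbhd_set G S = (\<Union>v\<in>S. closed_nbhd G v)"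

definition dominating_set :: "'a pair_pre_digraph \<Rightarrow> 'a set \<Rightarrow> bool" where
  "dominating_set G S \<longleftrightarrow> S \<subseteq> pverts G \<and> closed_nbhd_set G S = pverts G"

definition domination_number :: "'a pair_pre_digraph \<Rightarrow> nat" where
  "domination_number G = Min (card ` {S. dominating_set G S})"

definition cartesian_product ::
    "'a pair_pre_digraph \<Rightarrow> 'b pair_pre_digraph \<Rightarrow> ('a \<times> 'b) pair_pre_digraph" where
  "cartesian_product G H =
    \<lparr> pverts = pverts G \<times> pverts H,
      parcs = {((u1, v1), (u2, v2)) | u1 v1 u2 v2.
        u1 \<in> pverts G \<and> u2 \<in> pverts G \<and> v1 \<in> pverts H \<and> v2 \<in> pverts H \<and>
        ((v1 = v2 \<and> (u1, u2) \<in> parcs G) \<or> (u1 = u2 \<and> (v1, v2) \<in> parcs H))} \<rparr>"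

lemma pair_graph_cartesian_product:
  assumes "pair_graph G" "pair_graph H"
  shows "pair_graph (cartesian_product G H)"
proof -
  interpret G: pair_graph G by fact
  interpret H: pair_graph H by fact
  have sG: "(v, u) \<in> parcs G" if "(u, v) \<in> parcs G" for u v
    using that G.pair_sym_arcs by (auto simp: symmetric_def elim: symE)
  have sH: "(v, u) \<in> parcs H" if "(u, v) \<in> parcs H" for u v
    using that H.pair_sym_arcs by (auto simp: symmetric_def elim: symE)
  have "finite ((pverts G \<times> pverts H) \<times> (pverts G \<times> pverts H))"
    using G.pair_finite_verts H.pair_finite_verts by blast
  then have "finite (parcs (cartesian_product G H))"
    by (rule finite_subset[rotated]) (auto simp: cartesian_product_def)
  then show ?thesis
    using G.pair_finite_verts H.pair_finite_verts
    by unfold_locales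
      (auto simp: cartesian_product_def symmetric_def intro!: symI dest: sG sH
        G.pair_no_loops H.pair_no_loops)
qed

text \<open>The minimum in \<open>domination_number\<close> ranges over a finite nonempty set, hence is attained.\<close>

lemma domination_number_attained:
  assumes "pair_graph G"
  shows "\<exists>S. dominating_set G S \<and> card S = domination_number G"
    and "dominating_set G S \<Longrightarrow> domination_number G \<le> card S"
proof -
  interpret G: pair_graph G by fact
  have "{S. dominating_set G S} \<subseteq> Pow (pverts G)"
    by (auto simp: dominating_set_def)
  then have fin: "finite (card ` {S. dominating_set G S})"
    using G.pair_finite_verts by (meson finite_Pow_iff finite_imageI finite_subset)
  have "dominating_set G (pverts G)"
    by (auto simp: dominating_set_def closed_nbhd_set_def closed_nbhd_def dest: G.wellformed')
  then have "domination_number G \<in> card ` {S. dominating_set G S}"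
    unfolding domination_number_def using fin by (intro Min_in) auto
  then show "\<exists>S. dominating_set G S \<and> card S = domination_number G" by auto
  show "domination_number G \<le> card S" if "dominating_set G S"
    unfolding domination_number_def using fin that by (intro Min_le) auto
qed

end

theory Submission
  imports Defs
begin

text \<open>
  This refines the double counting of Clark and Suen. Fix a minimum dominating set \<open>\<Gamma>\<close> of \<open>G\<close> and a
  dominating set \<open>D\<close> of the product, and label every \<open>(x, h) \<in> D\<close> by an element of \<open>\<Gamma>\<close> that
  dominates \<open>x\<close>, namely by \<open>x\<close> itself if \<open>x \<in> \<Gamma>\<close>. For a row \<open>h\<close>, let \<open>X\<close> be the elements of \<open>D\<close> in that row, \<open>I\<close> their labels, and \<open>L\<close>
  the labels in the rows adjacent to \<open>h\<close>. Then \<open>X \<union> L\<close> dominates \<open>G\<close>, so \<open>|\<Gamma>| \<le> |X| + |L|\<close>.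
  On the other hand, for a label \<open>l\<close> the rows containing \<open>l\<close>, together with the rows in which \<open>l\<close> is
  missing from \<open>I \<union> L\<close>, dominate \<open>H\<close>; summing over \<open>l\<close> gives
  \<open>\<gamma>(G) \<gamma>(H) \<le> (\<Sum>h. |I| + |\<Gamma> - (I \<union> L)|)\<close>.

  The gain comes from choosing the labelling with the fewest pairs of equal labels in adjacent rows.
  If some \<open>j \<in> \<Gamma>\<close> is missing from \<open>I \<union> L\<close>, then \<open>j\<close> is dominated within the row, and relabelling
  its dominator by \<open>j\<close> creates no such pair; hence the present label of that dominator is not in \<open>L\<close>
  either, and \<open>|\<Gamma> - (I \<union> L)| \<le> |X| - 1\<close>. (A dominator in \<open>\<Gamma>\<close> cannot be relabelled, but if its label
  is in \<open>L\<close> it is counted twice in \<open>|X| + |L|\<close>, with the same effect.) So each nonempty row contributes at most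
  \<open>min |\<Gamma>| (2 |X| - 1)\<close>, which is at most \<open>(2 - 1 / c) |X|\<close> for \<open>c = \<lceil>|\<Gamma>| / 2\<rceil>\<close>.
\<close>

section \<open>Domination via arcs, and labellings\<close>

lemma mem_closed_nbhd_iff:
  "x \<in> closed_nbhd G v \<longleftrightarrow> x = v \<or> (v, x) \<in> parcs G"
  by (auto simp: closed_nbhd_def arcs_ends_def arc_to_ends_def)

lemma (in pair_graph) parcs_sym: "(u, v) \<in> parcs G \<Longrightarrow> (v, u) \<in> parcs G"
  using pair_sym_arcs by (auto simp: symmetric_def elim: symE)

lemma dominating_set_iff:
  assumes "pair_graph G"
  shows "dominating_set G S \<longleftrightarrow>
    S \<subseteq> pverts G \<and> (\<forall>x\<in>pverts G. \<exists>v\<in>S. x = v \<or> (v, x) \<in> parcs G)"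
proof -
  interpret G: pair_graph G by fact
  have "closed_nbhd_set G S \<subseteq> pverts G" if "S \<subseteq> pverts G"
    using that by (auto simp: closed_nbhd_set_def mem_closed_nbhd_iff dest: G.wellformed')
  moreover have "x \<in> closed_nbhd_set G S \<longleftrightarrow> (\<exists>v\<in>S. x = v \<or> (v, x) \<in> parcs G)" for x
    by (simp add: closed_nbhd_set_def mem_closed_nbhd_iff)
  ultimately show ?thesis
    unfolding dominating_set_def by blast
qed

text \<open>The last clause makes each vertex of \<Gamma> its own label, so a label absent from a
  row is absent there as a vertex too.\<close>

definition labelling ::
    "'a pair_pre_digraph \<Rightarrow> 'a set \<Rightarrow> ('a \<times> 'b) set \<Rightarrow> ('a \<times> 'b \<Rightarrow> 'a) \<Rightarrow> bool" where
  "labelling G \<Gamma> D lab \<longleftrightarrow>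
    (\<forall>d\<in>D. lab d \<in> \<Gamma> \<and> fst d \<in> closed_nbhd G (lab d) \<and> (fst d \<in> \<Gamma> \<longrightarrow> lab d = fst d))"

definition conflicts ::
    "'b pair_pre_digraph \<Rightarrow> ('a \<times> 'b) set \<Rightarrow> ('a \<times> 'b \<Rightarrow> 'a) \<Rightarrow> (('a \<times> 'b) \<times> ('a \<times> 'b)) set" where
  "conflicts H D lab =
    {(d, d'). d \<in> D \<and> d' \<in> D \<and> (snd d, snd d') \<in> parcs H \<and> lab d = lab d'}"

lemma ex_labelling:
  assumes "pair_graph G" "dominating_set G \<Gamma>" "D \<subseteq> pverts G \<times> W"
  shows "\<exists>lab. labelling G \<Gamma> D lab"
proof -
  have "\<forall>d\<in>D. \<exists>v. v \<in> \<Gamma> \<and> fst d \<in> closed_nbhd G v \<and> (fst d \<in> \<Gamma> \<longrightarrow> v = fst d)"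
  proof
    fix d assume "d \<in> D"
    then have "fst d \<in> pverts G" using assms(3) by auto
    then show "\<exists>v. v \<in> \<Gamma> \<and> fst d \<in> closed_nbhd G v \<and> (fst d \<in> \<Gamma> \<longrightarrow> v = fst d)"
      using assms(2) unfolding dominating_set_iff[OF assms(1)]
      by (cases "fst d \<in> \<Gamma>") (auto simp: mem_closed_nbhd_iff)
  qed
  then show ?thesis unfolding labelling_def by (rule bchoice)
qed

section \<open>Rows under a labelling with fewest conflicts\<close>

locale min_conflict_labelling =
  fixes G :: "'a pair_pre_digraph" and H :: "'b pair_pre_digraph"
    and \<Gamma> :: "'a set" and D :: "('a \<times> 'b) set" and lab :: "'a \<times> 'b \<Rightarrow> 'a"
  assumes graph_G: "pair_graph G" and graph_H: "pair_graph H"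
    and dom_\<Gamma>: "dominating_set G \<Gamma>" and card_\<Gamma>: "card \<Gamma> = domination_number G"
    and dom_D: "dominating_set (cartesian_product G H) D"
    and lab: "labelling G \<Gamma> D lab"
    and lab_min: "labelling G \<Gamma> D lab' \<Longrightarrow> card (conflicts H D lab) \<le> card (conflicts H D lab')"
begin

sublocale G: pair_graph G by (rule graph_G)
sublocale H: pair_graph H by (rule graph_H)

definition row :: "'b \<Rightarrow> 'a set" where
  "row h = {x. (x, h) \<in> D}"

definition row_labels :: "'b \<Rightarrow> 'a set" where
  "row_labels h = (\<lambda>x. lab (x, h)) ` row h"

definition nbr_labels :: "'b \<Rightarrow> 'a set" where
  "nbr_labels h = (\<Union>h'\<in>{h'. (h, h') \<in> parcs H}. row_labels h')"

definition missing :: "'b \<Rightarrow> 'a set" where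
  "missing h = \<Gamma> - (row_labels h \<union> nbr_labels h)"

lemma D_subset: "D \<subseteq> pverts G \<times> pverts H"
  using dom_D by (auto simp: dominating_set_def cartesian_product_def)

lemma finite_D: "finite D"
  using D_subset G.pair_finite_verts H.pair_finite_verts by (meson finite_SigmaI finite_subset)

lemma finite_\<Gamma>: "finite \<Gamma>"
  using dom_\<Gamma> G.pair_finite_verts by (auto simp: dominating_set_def intro: finite_subset)

lemma row_subset: "row h \<subseteq> pverts G"
  using D_subset by (auto simp: row_def)

lemma finite_row: "finite (row h)"
  using row_subset G.pair_finite_verts by (rule finite_subset)

lemma labelD:
  assumes "(x, h) \<in> D"
  shows "lab (x, h) \<in> \<Gamma>" and "x = lab (x, h) \<or> (lab (x, h), x) \<in> parcs G"
    and "x \<in> \<Gamma> \<Longrightarrow> lab (x, h) = x"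
  using lab assms by (auto simp: labelling_def mem_closed_nbhd_iff)

lemma row_labels_subset: "row_labels h \<subseteq> \<Gamma>"
  by (auto simp: row_labels_def row_def labelD)

lemma nbr_labels_subset: "nbr_labels h \<subseteq> \<Gamma>"
  using row_labels_subset by (auto simp: nbr_labels_def)

lemma card_row_labels_le: "card (row_labels h) \<le> card (row h)"
  unfolding row_labels_def by (rule card_image_le[OF finite_row])

lemma product_dominated:
  assumes "x \<in> pverts G" "h \<in> pverts H"
  obtains y where "y \<in> row h" "x = y \<or> (y, x) \<in> parcs G"
  | h' where "(h, h') \<in> parcs H" "(x, h') \<in> D"
proof -
  have "(x, h) \<in> pverts (cartesian_product G H)"
    using assms by (simp add: cartesian_product_def)
  then obtain d where d: "d \<in> D" "(x, h) = d \<or> (d, (x, h)) \<in> parcs (cartesian_product G H)"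
    using dom_D unfolding dominating_set_iff[OF pair_graph_cartesian_product[OF graph_G graph_H]]
    by blast
  obtain y k where "d = (y, k)" by (cases d)
  with d show thesis
    using that by (auto simp: cartesian_product_def row_def dest: H.parcs_sym)
qed

text \<open>A vertex dominated from an adjacent row is dominated in \<open>G\<close> by its label
  there.\<close>

lemma dominating_row_nbr_labels:
  assumes "h \<in> pverts H"
  shows "dominating_set G (row h \<union> nbr_labels h)"
  unfolding dominating_set_iff[OF graph_G]
proof (intro conjI ballI)
  show "row h \<union> nbr_labels h \<subseteq> pverts G"
    using row_subset nbr_labels_subset dom_\<Gamma> by (fastforce simp: dominating_set_def)
next
  fix x assume "x \<in> pverts G"
  then show "\<exists>v\<in>row h \<union> nbr_labels h. x = v \<or> (v, x) \<in> parcs G"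
  proof (rule product_dominated[OF _ assms])
    fix y assume "y \<in> row h" "x = y \<or> (y, x) \<in> parcs G"
    then show ?thesis by blast
  next
    fix h' assume "(h, h') \<in> parcs H" "(x, h') \<in> D"
    moreover from this have "lab (x, h') \<in> nbr_labels h"
      by (auto simp: nbr_labels_def row_labels_def row_def)
    ultimately show ?thesis using labelD(2) by blast
  qed
qed

lemma card_\<Gamma>_le: "h \<in> pverts H \<Longrightarrow> card \<Gamma> \<le> card (row h \<union> nbr_labels h)"
  unfolding card_\<Gamma>
  by (rule domination_number_attained(2)[OF graph_G dominating_row_nbr_labels])

lemma relabel:
  assumes x: "x \<in> row h" "x \<notin> \<Gamma>" and j: "j \<in> \<Gamma>" "(j, x) \<in> parcs G" "j \<notin> nbr_labels h"
  shows "lab (x, h) \<notin> nbr_labels h"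
proof
  assume "lab (x, h) \<in> nbr_labels h"
  then obtain y h' where y: "(h, h') \<in> parcs H" "(y, h') \<in> D" "lab (x, h) = lab (y, h')"
    by (auto simp: nbr_labels_def row_labels_def row_def)
  define lab' where "lab' = lab((x, h) := j)"
  have xD: "(x, h) \<in> D" using x by (simp add: row_def)
  have free: "lab (z, k) \<noteq> j" if "(h, k) \<in> parcs H" "(z, k) \<in> D" for z k
    using j(3) that by (auto simp: nbr_labels_def row_labels_def row_def)
  have noloop: "(k, k) \<notin> parcs H" for k
    using H.pair_no_loops[of "(k, k)"] by auto
  \<comment> \<open>As \<open>x\<close> lies outside \<Gamma>, the clause that fixes labels on
    \<Gamma> does not constrain the new label \<open>j\<close>.\<close>
  have "labelling G \<Gamma> D lab'"
    using lab x j by (auto simp: labelling_def lab'_def mem_closed_nbhd_iff)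
  then have "card (conflicts H D lab) \<le> card (conflicts H D lab')"
    by (rule lab_min)
  moreover have "conflicts H D lab' \<subset> conflicts H D lab"
  proof
    show "conflicts H D lab' \<subseteq> conflicts H D lab"
      by (auto simp: conflicts_def lab'_def noloop free free[symmetric] H.parcs_sym
          split: if_splits)
    have "((x, h), (y, h')) \<in> conflicts H D lab"
      using xD y by (simp add: conflicts_def)
    moreover have "((x, h), (y, h')) \<notin> conflicts H D lab'"
      using free[OF y(1,2)] y(1) noloop by (auto simp: conflicts_def lab'_def)
    ultimately show "conflicts H D lab' \<noteq> conflicts H D lab" by blast
  qed
  moreover have "finite (conflicts H D lab)"
    by (rule finite_subset[of _ "D \<times> D"]) (auto simp: conflicts_def finite_D)
  ultimately show False by (meson leD psubset_card_mono)
qed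

text \<open>With X, I, L for the row, its labels and the adjacent labels, |missing| + |I \<union> L|
  = |\<Gamma>| \<le> |X \<union> L|. So it suffices that X meets L or that I is not contained in
  L.\<close>

lemma card_missing_less:
  assumes h: "h \<in> pverts H" and "missing h \<noteq> {}"
  shows "card (missing h) < card (row h)"
proof -
  let ?X = "row h" and ?I = "row_labels h" and ?L = "nbr_labels h"
  have fin: "finite ?I" "finite ?L"
    by (rule finite_subset[OF row_labels_subset finite_\<Gamma>],
        rule finite_subset[OF nbr_labels_subset finite_\<Gamma>])
  have sub: "?I \<union> ?L \<subseteq> \<Gamma>"
    using row_labels_subset nbr_labels_subset by (rule Un_least)
  have card_eq: "card \<Gamma> = card (missing h) + card (?I \<union> ?L)"
    using card_Diff_subset[OF _ sub] card_mono[OF finite_\<Gamma> sub] fin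
    by (simp add: missing_def)
  obtain j where j: "j \<in> \<Gamma>" "j \<notin> ?I" "j \<notin> ?L"
    using assms(2) by (auto simp: missing_def)
  have "j \<in> pverts G" using j(1) dom_\<Gamma> by (auto simp: dominating_set_def)
  then obtain x where x: "x \<in> ?X" "(j, x) \<in> parcs G"
  proof (rule product_dominated[OF _ h])
    fix y assume y: "y \<in> ?X" "j = y \<or> (y, j) \<in> parcs G"
    \<comment> \<open>If \<open>j\<close> itself lay in the row, it would be its own label there,
      contrary to \<open>j\<close> being missing.\<close>
    have "j \<noteq> y"
      using j y(1) labelD(3)[of j h] by (force simp: row_labels_def row_def)
    then show thesis using that y G.parcs_sym by blast
  next
    fix h' assume "(h, h') \<in> parcs H" "(j, h') \<in> D"
    then have "j \<in> ?L"
      using labelD(3)[of j h'] j(1) by (force simp: nbr_labels_def row_labels_def row_def)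
    then show thesis using j by blast
  qed
  have xI: "lab (x, h) \<in> ?I" using x by (simp add: row_labels_def)
  show ?thesis
  proof (cases "lab (x, h) \<in> ?L")
    case True
    \<comment> \<open>Outside \<Gamma>, \<open>x\<close> could be relabelled by \<open>j\<close>,
      against minimality. Hence \<open>x\<close> is its own label and lies in both X and L.\<close>
    then have "x \<in> \<Gamma>" using relabel x j by blast
    then have "x \<in> ?X \<inter> ?L"
      using True x labelD(3)[of x h] by (auto simp: row_def)
    then have "card (?X \<union> ?L) < card ?X + card ?L"
      using card_Un_Int[OF finite_row fin(2), of h] finite_row card_gt_0_iff[of "?X \<inter> ?L"] by auto
    moreover have "card ?L \<le> card (?I \<union> ?L)"
      using fin by (intro card_mono) auto
    ultimately show ?thesis using card_\<Gamma>_le[OF h] card_eq by linarith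
  next
    case False
    then have "card ?L < card (?I \<union> ?L)"
      using fin xI by (intro psubset_card_mono) auto
    then show ?thesis
      using card_\<Gamma>_le[OF h] card_eq card_Un_le[of ?X ?L] by linarith
  qed
qed

section \<open>Counting by rows and by labels\<close>

lemma row_bound:
  assumes h: "h \<in> pverts H" and c: "card \<Gamma> \<le> 2 * c"
  shows "c * (card (row_labels h) + card (missing h)) \<le> (2 * c - 1) * card (row h)"
proof -
  let ?m = "card (row h)" and ?v = "card (row_labels h) + card (missing h)"
  have "?v = card (row_labels h \<union> missing h)"
    using row_labels_subset finite_\<Gamma>
    by (subst card_Un_disjoint) (auto simp: missing_def intro: finite_subset)
  also have "\<dots> \<le> card \<Gamma>"
    using row_labels_subset finite_\<Gamma> by (intro card_mono) (auto simp: missing_def)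
  finally have v1: "?v \<le> 2 * c" using c by simp
  \<comment> \<open>In an empty row truncated subtraction gives 0, and both sets are then
    empty.\<close>
  have v2: "?v \<le> 2 * ?m - 1"
  proof (cases "missing h = {}")
    case True
    then show ?thesis using card_row_labels_le[of h] by simp
  next
    case False
    then show ?thesis using card_missing_less[OF h] card_row_labels_le[of h] by fastforce
  qed
  show ?thesis
  \<comment> \<open>The inequality c(2m - 1) \<le> (2c - 1)m amounts to m \<le> c. For larger m the
    bound 2c suffices, as 2c * c \<le> (2c - 1)(c + 1).\<close>
  proof (cases "?m \<le> c")
    case True
    have "c * ?v \<le> c * (2 * ?m - 1)" using v2 by simp
    also have "\<dots> \<le> (2 * c - 1) * ?m"
      using True by (simp add: diff_mult_distrib diff_mult_distrib2)
    finally show ?thesis .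
  next
    case False
    have "c * ?v \<le> c * (2 * c)" using v1 by simp
    also have "\<dots> \<le> (2 * c - 1) * Suc c"
      by (cases c) auto
    also have "\<dots> \<le> (2 * c - 1) * ?m"
      using False by (intro mult_le_mono2) simp
    finally show ?thesis .
  qed
qed

text \<open>A row that neither carries nor misses \<open>l\<close> has \<open>l\<close> among the
  labels of an adjacent row, and that row carries \<open>l\<close>.\<close>

lemma label_bound:
  assumes l: "l \<in> \<Gamma>"
  shows "domination_number H \<le>
    card {h \<in> pverts H. l \<in> row_labels h} + card {h \<in> pverts H. l \<in> missing h}"
    (is "_ \<le> card ?P + card ?Q")
proof -
  have "dominating_set H (?P \<union> ?Q)"
    unfolding dominating_set_iff[OF graph_H]
  proof (intro conjI ballI)
    fix h assume h: "h \<in> pverts H"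
    show "\<exists>k\<in>?P \<union> ?Q. h = k \<or> (k, h) \<in> parcs H"
    proof (cases "l \<in> nbr_labels h")
      case True
      then obtain h' where "(h, h') \<in> parcs H" "l \<in> row_labels h'"
        by (auto simp: nbr_labels_def)
      then show ?thesis using H.parcs_sym H.wellformed' by fastforce
    next
      case False
      then show ?thesis using h l by (auto simp: missing_def)
    qed
  qed auto
  then have "domination_number H \<le> card (?P \<union> ?Q)"
    by (rule domination_number_attained(2)[OF graph_H])
  also have "\<dots> \<le> card ?P + card ?Q" by (rule card_Un_le)
  finally show ?thesis .
qed

lemma card_D: "card D = (\<Sum>h\<in>pverts H. card (row h))"
proof -
  have "(\<Sum>h\<in>pverts H. card (row h)) = card (SIGMA h:pverts H. row h)"
    using H.pair_finite_verts finite_row by simp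
  also have "(SIGMA h:pverts H. row h) = prod.swap ` D"
    using D_subset by (force simp: row_def)
  also have "card \<dots> = card D"
    by (rule card_image) (auto simp: inj_on_def)
  finally show ?thesis by simp
qed

text \<open>Double counting of the pairs (l, h) with \<open>l \<in> A h\<close>.\<close>

lemma sum_card_fibres:
  assumes "\<And>h. A h \<subseteq> \<Gamma>"
  shows "(\<Sum>l\<in>\<Gamma>. card {h \<in> pverts H. l \<in> A h}) = (\<Sum>h\<in>pverts H. card (A h))"
proof -
  have "A h = {l \<in> \<Gamma>. l \<in> A h}" for h using assms by auto
  then show ?thesis
    using sum.swap_restrict[OF finite_\<Gamma> H.pair_finite_verts, of "\<lambda>_ _. 1::nat" "\<lambda>l h. l \<in> A h"]
    by simp
qed

lemma clark_suen_bound: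
  assumes "card \<Gamma> \<le> 2 * c"
  shows "c * (card \<Gamma> * domination_number H) \<le> (2 * c - 1) * card D"
proof -
  have "card \<Gamma> * domination_number H \<le>
      (\<Sum>l\<in>\<Gamma>. card {h \<in> pverts H. l \<in> row_labels h} + card {h \<in> pverts H. l \<in> missing h})"
    using sum_mono[OF label_bound, of "\<Gamma>" "\<lambda>l. l"] by simp
  also have "\<dots> = (\<Sum>h\<in>pverts H. card (row_labels h) + card (missing h))"
    using sum_card_fibres[of row_labels] sum_card_fibres[of missing] row_labels_subset
    by (simp add: sum.distrib missing_def)
  finally have "c * (card \<Gamma> * domination_number H) \<le>
      (\<Sum>h\<in>pverts H. c * (card (row_labels h) + card (missing h)))"
    by (simp add: sum_distrib_left[symmetric])
  also have "\<dots> \<le> (\<Sum>h\<in>pverts H. (2 * c - 1) * card (row h))"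
    using assms by (intro sum_mono row_bound)
  also have "\<dots> = (2 * c - 1) * card D"
    by (simp add: card_D sum_distrib_left)
  finally show ?thesis .
qed

end

text \<open>Leaving \<open>c\<close> free covers both parities: it is later taken as half of the
  domination number of \<open>G\<close>, rounded up.\<close>

lemma domination_number_product_bound:
  assumes G: "pair_graph G" and H: "pair_graph H" and c: "domination_number G \<le> 2 * c"
  shows "c * (domination_number G * domination_number H) \<le>
    (2 * c - 1) * domination_number (cartesian_product G H)"
proof -
  obtain \<Gamma> where \<Gamma>: "dominating_set G \<Gamma>" "card \<Gamma> = domination_number G"
    using domination_number_attained(1)[OF G] by blast
  obtain D where D: "dominating_set (cartesian_product G H) D"
      "card D = domination_number (cartesian_product G H)"
    using domination_number_attained(1)[OF pair_graph_cartesian_product[OF G H]] by blast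
  have "D \<subseteq> pverts G \<times> pverts H"
    using D(1) by (auto simp: dominating_set_def cartesian_product_def)
  then have "\<exists>lab. labelling G \<Gamma> D lab"
    by (rule ex_labelling[OF G \<Gamma>(1)])
  then obtain lab where "labelling G \<Gamma> D lab"
      "\<And>lab'. labelling G \<Gamma> D lab' \<Longrightarrow> card (conflicts H D lab) \<le> card (conflicts H D lab')"
    using ex_has_least_nat[of "labelling G \<Gamma> D" _ "\<lambda>lab. card (conflicts H D lab)"] by blast
  then interpret min_conflict_labelling G H \<Gamma> D lab
    using G H \<Gamma> D by (intro min_conflict_labelling.intro)
  show ?thesis using clark_suen_bound c \<Gamma>(2) D(2) by simp
qed

section \<open>From natural numbers to real quotients\<close>

theorem theorem2p5:
  fixes G :: "'a pair_pre_digraph" and H :: "'b pair_pre_digraph"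
  assumes "pair_graph G" and "Digraph_Component.connected (with_proj G)"
    and "pair_graph H" and "Digraph_Component.connected (with_proj H)"
  shows "(odd (domination_number G) \<longrightarrow>
      real (domination_number (cartesian_product G H)) \<ge>
        real_of_int \<lceil>real (domination_number G) / 2\<rceil> /
          (2 * real_of_int \<lceil>real (domination_number G) / 2\<rceil> - 1) *
        real (domination_number G) * real (domination_number H)) \<and>
    (even (domination_number G) \<longrightarrow>
      real (domination_number (cartesian_product G H)) \<ge>
        real (domination_number G) / (2 * real (domination_number G) - 2) *
        real (domination_number G) * real (domination_number H))"
proof -
  let ?n = "domination_number G" and ?g = "domination_number H"
    and ?p = "domination_number (cartesian_product G H)"
  \<comment> \<open>Positivity of \<open>c\<close> makes the truncated \<open>2 * c - 1\<close>
    agree with the real difference and keeps the denominator positive.\<close>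
  have bound: "real c / (2 * real c - 1) * real ?n * real ?g \<le> real ?p"
    if c: "?n \<le> 2 * c" "c > 0" for c
  proof -
    have "real (c * (?n * ?g)) \<le> real ((2 * c - 1) * ?p)"
      using domination_number_product_bound[OF assms(1,3) c(1)] by (rule of_nat_mono)
    then have "real c * (real ?n * real ?g) \<le> (2 * real c - 1) * real ?p"
      using c(2) by (simp add: of_nat_diff)
    then show ?thesis
      using c(2) by (simp add: field_simps)
  qed
  show ?thesis
  proof (intro conjI impI)
    assume "odd ?n"
    then obtain k where k: "?n = 2 * k + 1" by (elim oddE)
    have "\<lceil>real ?n / 2\<rceil> = int (Suc k)"
      unfolding k by (rule ceiling_unique) auto
    then show "real_of_int \<lceil>real ?n / 2\<rceil> / (2 * real_of_int \<lceil>real ?n / 2\<rceil> - 1) * real ?n * real ?g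
        \<le> real ?p"
      using bound[of "Suc k"] k by simp
  next
    assume "even ?n"
    then obtain k where k: "?n = 2 * k" by (elim evenE)
    have "real ?n / (2 * real ?n - 2) = real k / (2 * real k - 1)"
    proof -
      have "real ?n / (2 * real ?n - 2) = (2 * real k) / (2 * (2 * real k - 1))"
        by (simp add: k)
      then show ?thesis by (simp only: mult_divide_mult_cancel_left_if) simp
    qed
    \<comment> \<open>For \<open>k = 0\<close>, where \<open>bound\<close> does not apply, the left
      side is 0.\<close>
    then show "real ?n / (2 * real ?n - 2) * real ?n * real ?g \<le> real ?p"
      using bound[of k] k by (cases "k = 0") auto
  qed
qed

end
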